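(* Let $i\in\mathbb{Z}$, let $M_-,M_+\in\mathbb{Z}$ with $M:=M_-+M_+\geq2$, and let $X=\mathrm{X}_{i-M_-,i+M_+}=\{x_{i-M_-},\dots,x_{i+M_+}\}$ be a stencil of real points $x_{i-M_-}<\cdots<x_{i+M_+}$. For every $K_{\mathrm{s}}\in\{1,\dots,M-1\}$ and $k_{\mathrm{s}}\in\{0,\dots,K_{\mathrm{s}}\}$ define real numbers recursively (for $X$ and likewise for each of its substencils of at least three consecutive points) by $$\beta_{\mathrm{X}_{i-M_-,i+M_+},K_{\mathrm{s}},k_{\mathrm{s}}}:=\begin{cases}\dfrac{1}{x_{i+M_+}-x_{i-M_-}} & K_{\mathrm{s}}=1,\\[2mm] \displaystyle\sum_{\ell_{\mathrm{s}}=\max(0,k_{\mathrm{s}}-1)}^{\min(K_{\mathrm{s}}-1,k_{\mathrm{s}})}\beta_{\mathrm{X}_{i-M_-,i+M_+},K_{\mathrm{s}}-1,\ell_{\mathrm{s}}}\;\beta_{\mathrm{X}_{i-M_-+\ell_{\mathrm{s}},\,i+M_+-(K_{\mathrm{s}}-1)+\ell_{\mathrm{s}}},1,k_{\mathrm{s}}-\ell_{\mathrm{s}}} & K_{\mathrm{s}}\geq2,\end{cases}$$ and polynomials $$\sigma_{\mathrm{X}_{i-M_-,i+M_+},K_{\mathrm{s}},k_{\mathrm{s}}}(x):=(-1)^{K_{\mathrm{s}}-k_{\mathrm{s}}}\,\beta_{\mathrm{X}_{i-M_-,i+M_+},K_{\mathrm{s}},k_{\mathrm{s}}}\prod_{x_n\in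 \mathrm{X}_{i-M_-,i+M_+}\setminus \mathrm{X}_{i-M_-+k_{\mathrm{s}},\,i+M_+-K_{\mathrm{s}}+k_{\mathrm{s}}}}(x-x_n).$$ Then, for all $K_{\mathrm{s}}\in\{1,\dots,M-1\}$ and $k_{\mathrm{s}}\in\{0,\dots,K_{\mathrm{s}}\}$: 1. $\beta_{\mathrm{X}_{i-M_-,i+M_+},K_{\mathrm{s}},k_{\mathrm{s}}}>0$, and $\sigma_{\mathrm{X}_{i-M_-,i+M_+},K_{\mathrm{s}},k_{\mathrm{s}}}$ is a real polynomial of degree $K_{\mathrm{s}}$ with only real roots. 2. For every function $f:\mathbb{R}\to\mathbb{R}$ and every $x\in\mathbb{R}$, $$p_{\mathrm{X}_{i-M_-,i+M_+}}(x;f)=\sum_{k_{\mathrm{s}}=0}^{K_{\mathrm{s}}}\sigma_{\mathrm{X}_{i-M_-,i+M_+},K_{\mathrm{s}},k_{\mathrm{s}}}(x)\;p_{\mathrm{X}_{i-M_-+k_{\mathrm{s}},\,i+M_+-K_{\mathrm{s}}+k_{\mathrm{s}}}}(x;f).$$ 3. For every $x\in\mathbb{R}$, $\displaystyle\sum_{k_{\mathrm{s}}=0}^{K_{\mathrm{s}}}\sigma_{\mathrm{X}_{i-M_-,i+M_+},K_{\mathrm{s}},k_{\mathrm{s}}}(x)=1$. 4. If $K_{\mathrm{s}}\geq2$, then for every $x\in\mathbb{R}$ $$\sigma_{\mathrm{X}_{i-M_-,i+M_+},K_{\mathrm{s}},k_{\mathrm{s}}}(x)=\sum_{\ell_{\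mathrm{s}}=\max(0,k_{\mathrm{s}}-1)}^{\min(K_{\mathrm{s}}-1,k_{\mathrm{s}})}\sigma_{\mathrm{X}_{i-M_-,i+M_+},K_{\mathrm{s}}-1,\ell_{\mathrm{s}}}(x)\;\sigma_{\mathrm{X}_{i-M_-+\ell_{\mathrm{s}},\,i+M_+-(K_{\mathrm{s}}-1)+\ell_{\mathrm{s}}},1,k_{\mathrm{s}}-\ell_{\mathrm{s}}}(x).$$
   Context: For integers $a\leq b$ and real points $x_a<\cdots<x_b$, write $\mathrm{X}_{a,b}:=\{x_a,\dots,x_b\}$ (a stencil). For $f:\mathbb{R}\to\mathbb{R}$, $p_{\mathrm{X}_{a,b}}(x;f)$ denotes the Lagrange interpolating polynomial of $f$ on $\mathrm{X}_{a,b}$, i.e. the unique polynomial of degree $\leq b-a$ agreeing with $f$ at $x_a,\dots,x_b$. For $\mathrm{X}_{i-M_-,i+M_+}$ with $M:=M_-+M_+\geq2$ and $K_{\mathrm{s}}\in\{1,\dots,M-1\}$, the $K_{\mathrm{s}}$-level (Neville) substencils are the $K_{\mathrm{s}}+1$ sets $\mathrm{X}_{i-M_-+k_{\mathrm{s}},\,i+M_+-K_{\mathrm{s}}+k_{\mathrm{s}}}$, $k_{\mathrm{s}}\in\{0,\dots,K_{\mathrm{s}}\}$, each containing $M-K_{\mathrm{s}}+1$ consecutive points of the stencil. *)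

theory Defs
  imports Complex_Main "HOL-Computational_Algebra.Polynomial"
begin

definition stencil :: "(int \<Rightarrow> real) \<Rightarrow> int \<Rightarrow> int \<Rightarrow> real set" where
  "stencil x a b = x ` {a..b}"

(* Well defined whenever a \<le> b and the points x a, ..., x b are distinct. *)
definition lagrange_poly :: "(int \<Rightarrow> real) \<Rightarrow> int \<Rightarrow> int \<Rightarrow> (real \<Rightarrow> real) \<Rightarrow> real poly" where
  "lagrange_poly x a b f =
     (THE p. int (degree p) \<le> b - a \<and> (\<forall>y\<in>stencil x a b. poly p y = f y))"

(* neville_beta x a b K k belongs to the stencil x a, ..., x b and is meaningful for
   1 \<le> K < b - a and k \<le> K; level 0 is a dummy value. In the last equation the level is
   Suc (Suc K), so Suc K is the previous level, and the truncated k - 1 on nat agrees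
   with max(0, k - 1). *)
fun neville_beta :: "(int \<Rightarrow> real) \<Rightarrow> int \<Rightarrow> int \<Rightarrow> nat \<Rightarrow> nat \<Rightarrow> real" where
  "neville_beta x a b 0 k = 0"
| "neville_beta x a b (Suc 0) k = 1 / (x b - x a)"
| "neville_beta x a b (Suc (Suc K)) k =
     (\<Sum>l = max 0 (k - 1)..min (Suc K) k.
        neville_beta x a b (Suc K) l *
        neville_beta x (a + int l) (b - int (Suc K) + int l) (Suc 0) (k - l))"

definition neville_sigma :: "(int \<Rightarrow> real) \<Rightarrow> int \<Rightarrow> int \<Rightarrow> nat \<Rightarrow> nat \<Rightarrow> real poly" where
  "neville_sigma x a b K k =
     smult ((- 1) ^ (K - k) * neville_beta x a b K k)
       (\<Prod>y\<in>stencil x a b - stencil x (a + int k) (b - int K + int k). [:- y, 1:])"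

end

theory Submission
  imports Defs
begin

text \<open>
  The Aitken--Neville identity is the case of level one. A higher level is reached by applying it
  once more to every substencil of the previous level: each substencil splits into its left and
  right halves, and the recursion for the coefficients collects the two contributions that arrive
  at a common half. The partition of unity is the decomposition of the constant function one.
\<close>

section \<open>Regrouping a double sum, and products of linear factors over the complex
  numbers\<close>

lemma sum_adjacent_swap:
  fixes F :: "nat \<Rightarrow> nat \<Rightarrow> 'a::comm_monoid_add"
  shows "(\<Sum>k = 0..Suc N. \<Sum>l = max 0 (k - 1)..min N k. F k l) =
         (\<Sum>l = 0..N. F l l + F (Suc l) l)"
proof -
  \<comment> \<open>The truncated bounds encode a mere relation: k is \<open>l\<close> or
    \<open>Suc l\<close>. In this form the sums can be swapped, and each \<open>l\<close> meets
    exactly two values of \<open>k\<close>.\<close>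
  have "(\<Sum>k = 0..Suc N. \<Sum>l = max 0 (k - 1)..min N k. F k l) =
        (\<Sum>k = 0..Suc N. \<Sum>l | l \<in> {0..N} \<and> (k = l \<or> k = Suc l). F k l)"
    by (intro sum.cong refl) auto
  also have "\<dots> = (\<Sum>l = 0..N. \<Sum>k | k \<in> {0..Suc N} \<and> (k = l \<or> k = Suc l). F k l)"
    by (rule sum.swap_restrict) auto
  also have "\<dots> = (\<Sum>l = 0..N. \<Sum>k\<in>{l, Suc l}. F k l)"
    by (intro sum.cong refl) auto
  finally show ?thesis by simp
qed

lemma map_poly_of_real_mult:
  "map_poly complex_of_real (p * q) = map_poly complex_of_real p * map_poly complex_of_real q"
  by (rule poly_eqI) (simp add: coeff_map_poly coeff_mult)

lemma map_poly_of_real_prod_linear: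
  "map_poly complex_of_real (\<Prod>y\<in>A. [:- y, 1:]) = (\<Prod>y\<in>A. [:- complex_of_real y, 1:])"
  by (induction A rule: infinite_finite_induct)
     (simp_all add: map_poly_of_real_mult map_poly_pCons del: mult_pCons_left)

section \<open>The coefficients and the weight polynomials\<close>

lemma neville_beta_pos:
  assumes "strict_mono_on {a..b} x" "1 \<le> K" "int K \<le> b - a" "k \<le> K"
  shows "neville_beta x a b K k > 0"
  using assms(2-4)
proof (induction K arbitrary: k rule: dec_induct)
  case base
  then show ?case
    using strict_mono_onD[OF assms(1), of a b] by simp
next
  case (step K)
  obtain N where N: "K = Suc N"
    using \<open>1 \<le> K\<close> by (cases K) auto
  show ?case
    unfolding N neville_beta.simps
  proof (rule sum_pos)
    fix l assume l: "l \<in> {max 0 (k - 1)..min (Suc N) k}"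
    \<comment> \<open>Since \<open>Suc K\<close> is at most b - a, a substencil of level
      \<open>K\<close> still has at least two points, so its end points differ in the right
      order.\<close>
    have "x (a + int l) < x (b - int K + int l)"
      using l step N by (intro strict_mono_onD[OF assms(1)]) auto
    moreover have "neville_beta x a b K l > 0"
      using step l N by (intro step.IH) auto
    ultimately show "0 < neville_beta x a b (Suc N) l *
        (1 / (x (b - int (Suc N) + int l) - x (a + int l)))"
      unfolding N by (intro mult_pos_pos) simp_all
  qed (use step N in auto)
qed

text \<open>Indices instead of points: with \<open>x\<close> injective, products over removed points
  become products over two integer intervals, whose size and disjointness are plain
  arithmetic.\<close>

abbreviation omitted :: "int \<Rightarrow> int \<Rightarrow> nat \<Rightarrow> nat \<Rightarrow> int set" where
  "omitted a b K k \<equiv> {a..<a + int k} \<union> {b - int K + int k<..b}"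

lemma stencil_diff:
  assumes "inj_on x {a..b}" "int K \<le> b - a" "k \<le> K"
  shows "stencil x a b - stencil x (a + int k) (b - int K + int k) = x ` omitted a b K k"
proof -
  have "x ` {a..b} - x ` {a + int k..b - int K + int k} =
        x ` ({a..b} - {a + int k..b - int K + int k})"
    using assms by (intro inj_on_image_set_diff[symmetric, of x "{a..b}"]) auto
  also have "{a..b} - {a + int k..b - int K + int k} = omitted a b K k"
    using assms by auto
  finally show ?thesis
    by (simp add: stencil_def)
qed

lemma poly_neville_sigma:
  assumes "inj_on x {a..b}" "int K \<le> b - a" "k \<le> K"
  shows "poly (neville_sigma x a b K k) t =
    (- 1) ^ (K - k) * neville_beta x a b K k * (\<Prod>n\<in>omitted a b K k. t - x n)"
proof -
  have "inj_on x (omitted a b K k)"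
    by (rule inj_on_subset[OF assms(1)]) (use assms in auto)
  then show ?thesis
    by (simp add: neville_sigma_def stencil_diff[OF assms] poly_prod prod.reindex)
qed

lemma degree_neville_sigma:
  assumes "strict_mono_on {a..b} x" "1 \<le> K" "int K \<le> b - a" "k \<le> K"
  shows "degree (neville_sigma x a b K k) = K"
proof -
  have inj: "inj_on x {a..b}"
    using assms(1) by (rule strict_mono_on_imp_inj_on)
  have "card (x ` omitted a b K k) = card (omitted a b K k)"
    by (rule card_image, rule inj_on_subset[OF inj]) (use assms in auto)
  \<comment> \<open>There are k indices on the left and K - k on the right, and the retained block
    between them is nonempty.\<close>
  also have "\<dots> = K"
    using assms by (subst card_Un_disjoint) auto
  finally show ?thesis
    using neville_beta_pos[OF assms]
    by (simp add: neville_sigma_def stencil_diff[OF inj assms(3,4)] degree_prod_sum_eq)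
qed

text \<open>Real-rootedness has to be expressed over the complex numbers. The scalar in front is
  nonzero, so a complex root must annihilate one of the linear factors, all of which have real
  roots.\<close>

lemma neville_sigma_real_roots:
  assumes "neville_beta x a b K k \<noteq> 0"
    and "poly (map_poly complex_of_real (neville_sigma x a b K k)) z = 0"
  shows "z \<in> \<real>"
proof -
  let ?A = "stencil x a b - stencil x (a + int k) (b - int K + int k)"
  have "(\<Prod>y\<in>?A. z - complex_of_real y) = 0"
    using assms
    by (simp add: neville_sigma_def map_poly_smult map_poly_of_real_prod_linear poly_prod)
  then obtain y where "z = complex_of_real y"
    by (auto simp: prod_zero_iff stencil_def)
  then show ?thesis by simp
qed

text \<open>All summands share the same sign and the same product of linear factors. Once these are
  pulled out, what remains is the recursion defining \<open>neville_beta\<close>.\<close>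

lemma neville_sigma_Suc:
  assumes "inj_on x {a..b}" "1 \<le> K" "int (Suc K) \<le> b - a" "k \<le> Suc K"
  shows "poly (neville_sigma x a b (Suc K) k) t =
    (\<Sum>l = max 0 (k - 1)..min K k. poly (neville_sigma x a b K l) t *
       poly (neville_sigma x (a + int l) (b - int K + int l) 1 (k - l)) t)"
proof -
  obtain N where N: "K = Suc N"
    using assms(2) by (cases K) auto
  have "poly (neville_sigma x a b K l) t *
          poly (neville_sigma x (a + int l) (b - int K + int l) 1 (k - l)) t =
        neville_beta x a b K l * neville_beta x (a + int l) (b - int K + int l) 1 (k - l) *
          ((- 1) ^ (Suc K - k) * (\<Prod>n\<in>omitted a b (Suc K) k. t - x n))"
    if l: "l \<in> {max 0 (k - 1)..min K k}" for l
  proof -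
    let ?B = "omitted (a + int l) (b - int K + int l) 1 (k - l)"
    have inj: "inj_on x {a + int l..b - int K + int l}"
      by (rule inj_on_subset[OF assms(1)]) (use l in auto)
    \<comment> \<open>Passing from X to the final substencil through parent \<open>l\<close> first
      drops \<open>K\<close> points and then one end point of the parent, so the two index sets are
      disjoint.\<close>
    have "omitted a b (Suc K) k = omitted a b K l \<union> ?B"
      using l assms by auto
    then have "(\<Prod>n\<in>omitted a b (Suc K) k. t - x n) =
        (\<Prod>n\<in>omitted a b K l. t - x n) * (\<Prod>n\<in>?B. t - x n)"
      using l assms by (simp only:, intro prod.union_disjoint) auto
    \<comment> \<open>No subtraction truncates here, because \<open>l\<close> is at most
      \<open>K\<close> and k - l is 0 or 1.\<close>
    moreover have "(- 1 :: real) ^ (K - l) * (- 1) ^ (1 - (k - l)) = (- 1) ^ (Suc K - k)"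
      using l assms by (subst power_add[symmetric], intro arg_cong[where f = "(^) (- 1)"]) auto
    ultimately show ?thesis
      using l assms
      by (subst (1 2) poly_neville_sigma) (auto intro: inj simp: mult_ac)
  qed
  then show ?thesis
    using assms by (simp add: poly_neville_sigma N sum_distrib_left sum_distrib_right mult_ac)
qed

section \<open>Uniqueness, existence and the one-level identity for interpolating
  polynomials\<close>

lemma lagrange_polyI:
  assumes "inj_on x {a..b}" "int (degree p) \<le> b - a" "\<And>n. n \<in> {a..b} \<Longrightarrow> poly p (x n) = f (x n)"
  shows "lagrange_poly x a b f = p"
  unfolding lagrange_poly_def
proof (rule the_equality)
  fix q assume q: "int (degree q) \<le> b - a \<and> (\<forall>y\<in>stencil x a b. poly q y = f y)"
  have card: "card (stencil x a b) = nat (b - a + 1)"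
    using assms(1) by (simp add: stencil_def card_image)
  show "q = p"
  proof (rule poly_eqI_degree[where A = "stencil x a b"])
    show "poly q y = poly p y" if "y \<in> stencil x a b" for y
      using that q assms(3) by (auto simp: stencil_def)
  qed (use q assms(2) card in auto)
qed (use assms in \<open>auto simp: stencil_def\<close>)

text \<open>The two weights add up to 1, so at nodes shared by \<open>p\<close> and \<open>q\<close>
  the common value survives; at an end node the weight of the polynomial that misses it vanishes.
  Taking arbitrary \<open>p\<close> and \<open>q\<close> lets this serve both the existence proof
  and the identity for \<open>lagrange_poly\<close>.\<close>

lemma neville_interpolation:
  fixes p q :: "real poly" and x :: "int \<Rightarrow> real" and a b :: int
  defines "r \<equiv> smult (1 / (x b - x a)) ([:- x a, 1:] * q - [:- x b, 1:] * p)"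
  assumes "inj_on x {a..b}" "a < b"
    and "int (degree p) \<le> b - 1 - a" "\<And>n. n \<in> {a..b - 1} \<Longrightarrow> poly p (x n) = f (x n)"
    and "int (degree q) \<le> b - (a + 1)" "\<And>n. n \<in> {a + 1..b} \<Longrightarrow> poly q (x n) = f (x n)"
  shows "int (degree r) \<le> b - a" "\<And>n. n \<in> {a..b} \<Longrightarrow> poly r (x n) = f (x n)"
proof -
  have "degree ([:- x a, 1:] * q) \<le> nat (b - a)" "degree ([:- x b, 1:] * p) \<le> nat (b - a)"
    using assms(3-7) degree_mult_le[of "[:- x a, 1:]" q] degree_mult_le[of "[:- x b, 1:]" p]
    by auto
  then have "degree r \<le> nat (b - a)"
    unfolding r_def by (intro order.trans[OF degree_smult_le] degree_diff_le)
  then show "int (degree r) \<le> b - a"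
    using assms(3) by linarith
next
  fix n assume n: "n \<in> {a..b}"
  have ne: "x b - x a \<noteq> 0"
    using inj_onD[OF assms(2), of b a] assms(3) by auto
  consider "n = a" | "n = b" | "n \<in> {a..b - 1}" "n \<in> {a + 1..b}"
    using n by force
  then have "(x n - x a) * poly q (x n) - (x n - x b) * poly p (x n) = (x b - x a) * f (x n)"
  proof cases
    case 1
    then show ?thesis using assms(3) assms(5)[of a] by (simp add: algebra_simps)
  next
    case 2
    then show ?thesis using assms(3) assms(7)[of b] by simp
  next
    case 3
    then show ?thesis using assms(5,7) by (simp add: algebra_simps)
  qed
  moreover have "poly r (x n) =
      ((x n - x a) * poly q (x n) - (x n - x b) * poly p (x n)) / (x b - x a)"
    by (simp add: r_def add_divide_distrib diff_divide_distrib algebra_simps)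
  ultimately show "poly r (x n) = f (x n)"
    using ne by simp
qed

lemma lagrange_poly:
  assumes "inj_on x {a..b}" "a \<le> b"
  shows "int (degree (lagrange_poly x a b f)) \<le> b - a"
    and "\<And>n. n \<in> {a..b} \<Longrightarrow> poly (lagrange_poly x a b f) (x n) = f (x n)"
proof -
  \<comment> \<open>Existence by induction on the length of the index interval: the Neville
    combination of interpolants on the two halves is itself the witness.\<close>
  have "\<exists>p. int (degree p) \<le> b - a \<and> (\<forall>n\<in>{a..b}. poly p (x n) = f (x n))"
    using assms(2,1)
  proof (induction "nat (b - a)" arbitrary: a b)
    case 0
    then have "b = a" by simp
    then show ?case by (intro exI[of _ "[:f (x a):]"]) auto
  next
    case (Suc m)
    have "inj_on x {a..b - 1}" "inj_on x {a + 1..b}"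
      by (auto intro: inj_on_subset[OF Suc.prems(2)])
    moreover have "m = nat (b - 1 - a)" "m = nat (b - (a + 1))" "a \<le> b - 1" "a + 1 \<le> b"
      using Suc.hyps(2) by auto
    ultimately obtain p q where
      "int (degree p) \<le> b - 1 - a" "\<forall>n\<in>{a..b - 1}. poly p (x n) = f (x n)"
      "int (degree q) \<le> b - (a + 1)" "\<forall>n\<in>{a + 1..b}. poly q (x n) = f (x n)"
      using Suc.hyps(1)[of "b - 1" a] Suc.hyps(1)[of b "a + 1"] by blast
    moreover have "a < b"
      using Suc.hyps(2) by simp
    ultimately show ?case
      using neville_interpolation[OF Suc.prems(2), of p f q] by blast
  qed
  then obtain p where p: "int (degree p) \<le> b - a" "\<And>n. n \<in> {a..b} \<Longrightarrow> poly p (x n) = f (x n)"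
    by auto
  have "lagrange_poly x a b f = p"
    using assms(1) p by (rule lagrange_polyI)
  with p show "int (degree (lagrange_poly x a b f)) \<le> b - a"
    and "\<And>n. n \<in> {a..b} \<Longrightarrow> poly (lagrange_poly x a b f) (x n) = f (x n)"
    by auto
qed

lemma lagrange_poly_neville_step:
  assumes "inj_on x {a..b}" "a < b"
  shows "poly (lagrange_poly x a b f) t =
    poly (neville_sigma x a b 1 0) t * poly (lagrange_poly x a (b - 1) f) t +
    poly (neville_sigma x a b 1 1) t * poly (lagrange_poly x (a + 1) b f) t"
proof -
  let ?p = "lagrange_poly x a (b - 1) f" and ?q = "lagrange_poly x (a + 1) b f"
  have inj: "inj_on x {a..b - 1}" "inj_on x {a + 1..b}"
    by (auto intro: inj_on_subset[OF assms(1)])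
  have p: "int (degree ?p) \<le> b - 1 - a" "\<And>n. n \<in> {a..b - 1} \<Longrightarrow> poly ?p (x n) = f (x n)"
    using lagrange_poly[OF inj(1)] assms(2) by auto
  have q: "int (degree ?q) \<le> b - (a + 1)" "\<And>n. n \<in> {a + 1..b} \<Longrightarrow> poly ?q (x n) = f (x n)"
    using lagrange_poly[OF inj(2)] assms(2) by auto
  have eq: "lagrange_poly x a b f =
      smult (1 / (x b - x a)) ([:- x a, 1:] * ?q - [:- x b, 1:] * ?p)"
    using neville_interpolation[OF assms p q] by (intro lagrange_polyI assms(1))
  \<comment> \<open>The left half omits the point with index \<open>b\<close> and the right half the
    one with index \<open>a\<close>; the sign (-1)^(1 - 0) accounts for the subtracted term of the
    Neville combination.\<close>
  have "omitted a b 1 0 = {b}" "omitted a b 1 1 = {a}"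
    by auto
  then have sigma: "poly (neville_sigma x a b 1 0) t = - (1 / (x b - x a) * (t - x b))"
    "poly (neville_sigma x a b 1 1) t = 1 / (x b - x a) * (t - x a)"
    using assms by (simp_all add: poly_neville_sigma)
  show ?thesis
    unfolding sigma by (simp add: eq add_divide_distrib diff_divide_distrib algebra_simps)
qed

section \<open>Higher levels and the partition of unity\<close>

lemma lagrange_poly_neville:
  assumes "inj_on x {a..b}" "1 \<le> K" "int K \<le> b - a"
  shows "poly (lagrange_poly x a b f) t =
    (\<Sum>k = 0..K. poly (neville_sigma x a b K k) t *
       poly (lagrange_poly x (a + int k) (b - int K + int k) f) t)"
  using assms(2,3)
proof (induction K rule: dec_induct)
  case base
  then show ?case
    using lagrange_poly_neville_step[OF assms(1)] by simp
next
  case (step K)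
  let ?s = "\<lambda>l. neville_sigma x (a + int l) (b - int K + int l) 1"
  let ?p = "\<lambda>k. poly (lagrange_poly x (a + int k) (b - int (Suc K) + int k) f) t"
  have "(\<Sum>k = 0..Suc K. poly (neville_sigma x a b (Suc K) k) t * ?p k) =
        (\<Sum>k = 0..Suc K. \<Sum>l = max 0 (k - 1)..min K k.
           poly (neville_sigma x a b K l) t * poly (?s l (k - l)) t * ?p k)"
    using neville_sigma_Suc[OF assms(1) step.hyps(1) step.prems]
    by (intro sum.cong refl) (simp add: sum_distrib_right)
  \<comment> \<open>Regrouping by the parent \<open>l\<close> leaves, in each bracket, the one-level
    decomposition of the interpolant on that parent.\<close>
  also have "\<dots> = (\<Sum>l = 0..K. poly (neville_sigma x a b K l) t *
      (poly (?s l 0) t * ?p l + poly (?s l 1) t * ?p (Suc l)))"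
    by (subst sum_adjacent_swap) (simp add: algebra_simps)
  also have "\<dots> = (\<Sum>l = 0..K. poly (neville_sigma x a b K l) t *
      poly (lagrange_poly x (a + int l) (b - int K + int l) f) t)"
  proof (intro sum.cong refl)
    fix l assume l: "l \<in> {0..K}"
    have "inj_on x {a + int l..b - int K + int l}"
      by (rule inj_on_subset[OF assms(1)]) (use l in auto)
    then have "poly (lagrange_poly x (a + int l) (b - int K + int l) f) t =
        poly (?s l 0) t * poly (lagrange_poly x (a + int l) (b - int K + int l - 1) f) t +
        poly (?s l 1) t * poly (lagrange_poly x (a + int l + 1) (b - int K + int l) f) t"
      using step.prems by (intro lagrange_poly_neville_step) auto
    \<comment> \<open>The substencils number \<open>l\<close> and \<open>Suc l\<close> of level
      \<open>Suc K\<close> are exactly the left and right halves of parent \<open>l\<close>.\<close>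
    moreover have "b - int (Suc K) + int l = b - int K + int l - 1"
      "b - int (Suc K) + int (Suc l) = b - int K + int l" "a + int (Suc l) = a + int l + 1"
      by auto
    ultimately show "poly (neville_sigma x a b K l) t *
        (poly (?s l 0) t * ?p l + poly (?s l 1) t * ?p (Suc l)) =
        poly (neville_sigma x a b K l) t *
        poly (lagrange_poly x (a + int l) (b - int K + int l) f) t"
      by (simp only:)
  qed
  finally show ?case
    using step by simp
qed

lemma neville_sigma_sum_eq_1:
  assumes "inj_on x {a..b}" "1 \<le> K" "int K \<le> b - a"
  shows "(\<Sum>k = 0..K. poly (neville_sigma x a b K k) t) = 1"
proof -
  \<comment> \<open>Every substencil is nonempty as \<open>K\<close> is at most b - a, so the
    constant 1 meets the degree bound and is its own interpolant.\<close>
  have "lagrange_poly x (a + int k) (b - int K + int k) (\<lambda>_. 1) = 1" if "k \<le> K" for k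
    using that assms by (intro lagrange_polyI inj_on_subset[OF assms(1)]) auto
  moreover have "lagrange_poly x a b (\<lambda>_. 1) = 1"
    using assms by (intro lagrange_polyI) auto
  ultimately show ?thesis
    using lagrange_poly_neville[OF assms, of "\<lambda>_. 1" t] by simp
qed

theorem proposition3p1:
  fixes i Mm Mp :: int and x :: "int \<Rightarrow> real" and Ks ks :: nat
  assumes "Mm + Mp \<ge> 2"
    and "strict_mono_on {i - Mm..i + Mp} x"
    and "1 \<le> Ks" and "int Ks \<le> Mm + Mp - 1"
    and "ks \<le> Ks"
  shows "(neville_beta x (i - Mm) (i + Mp) Ks ks > 0 \<and>
          degree (neville_sigma x (i - Mm) (i + Mp) Ks ks) = Ks \<and>
          (\<forall>z :: complex. poly (map_poly complex_of_real
             (neville_sigma x (i - Mm) (i + Mp) Ks ks)) z = 0 \<longrightarrow> z \<in> \<real>)) \<and>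
         (\<forall>(f :: real \<Rightarrow> real) (t :: real).
            poly (lagrange_poly x (i - Mm) (i + Mp) f) t =
            (\<Sum>k = 0..Ks. poly (neville_sigma x (i - Mm) (i + Mp) Ks k) t *
               poly (lagrange_poly x (i - Mm + int k) (i + Mp - int Ks + int k) f) t)) \<and>
         (\<forall>t :: real. (\<Sum>k = 0..Ks. poly (neville_sigma x (i - Mm) (i + Mp) Ks k) t) = 1) \<and>
         (Ks \<ge> 2 \<longrightarrow> (\<forall>t :: real.
            poly (neville_sigma x (i - Mm) (i + Mp) Ks ks) t =
            (\<Sum>l = max 0 (ks - 1)..min (Ks - 1) ks.
               poly (neville_sigma x (i - Mm) (i + Mp) (Ks - 1) l) t *
               poly (neville_sigma x (i - Mm + int l) (i + Mp - int (Ks - 1) + int l)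
                       1 (ks - l)) t)))"
proof -
  note mono = assms(2)
  have inj: "inj_on x {i - Mm..i + Mp}"
    using mono by (rule strict_mono_on_imp_inj_on)
  have le: "int Ks \<le> i + Mp - (i - Mm)"
    using assms(4) by simp
  have beta: "neville_beta x (i - Mm) (i + Mp) Ks ks > 0"
    by (rule neville_beta_pos[OF mono assms(3) le assms(5)])
  \<comment> \<open>With \<open>Ks\<close> at least 2 the preceding level \<open>Ks - 1\<close> is
    at least 1, which keeps the dummy level 0 of \<open>neville_beta\<close> out of the
    recursion.\<close>
  have rec: "poly (neville_sigma x (i - Mm) (i + Mp) Ks ks) t =
      (\<Sum>l = max 0 (ks - 1)..min (Ks - 1) ks.
         poly (neville_sigma x (i - Mm) (i + Mp) (Ks - 1) l) t *
         poly (neville_sigma x (i - Mm + int l) (i + Mp - int (Ks - 1) + int l) 1 (ks - l)) t)"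
    if "Ks \<ge> 2" for t
    using neville_sigma_Suc[OF inj, of "Ks - 1" ks t] that le assms(5) by simp
  show ?thesis
    using beta degree_neville_sigma[OF mono assms(3) le assms(5)]
      neville_sigma_real_roots[of x "i - Mm" "i + Mp" Ks ks]
      lagrange_poly_neville[OF inj assms(3) le] neville_sigma_sum_eq_1[OF inj assms(3) le] rec
    by (intro conjI allI impI) simp_all
qed

end
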